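(* Let $\theta=\frac35$. Let $a(t)=(a_j(t))_{j\ge 0}$, $t\ge 0$, be any positive solution of the inviscid dyadic model $$\frac{d}{dt}a_j(t)=\lambda_{j-1}^{5/2}a_{j-1}^2(t)-\lambda_j^{5/2}a_j(t)a_{j+1}(t),\quad j=1,2,\dots,\qquad a_0(t)=0,$$ with initial condition $a(0)\in l^2$. Then for every $t>0$, $$\sup_{j}\lambda_j^{\theta}a_j(t)<\infty .$$
   Context: Here $\lambda=2$ and $\lambda_j=2^j$. A solution is a sequence of real-valued functions $a(t)=(a_j(t))_{j\ge0}$ on $[0,\infty)$, with each $a_j$ continuously differentiable, satisfying the system for all $t\ge 0$. A solution $a(t)$ is called positive if $a_j(t)\ge 0$ for all $j$ and all times $t$. $l^2$ is the space of square-summable real sequences. *)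

theory Defs
  imports "HOL-Analysis.Analysis"
begin

definition lam :: "nat \<Rightarrow> real" where
  "lam j = 2 ^ j"

text \<open>Functions of time are total on the reals, but only their values on \<open>{0..}\<close> are constrained;
  the derivative at time 0 is one-sided. The function \<open>a' j\<close> is the time derivative of \<open>a j\<close>,
  and the component \<open>a 0\<close> is only subject to the boundary condition, not to an evolution
  equation.\<close>

definition dyadic_solution :: "(nat \<Rightarrow> real \<Rightarrow> real) \<Rightarrow> bool" where
  "dyadic_solution a \<longleftrightarrow>
    (\<exists>a'. (\<forall>j. (\<forall>t\<ge>0. (a j has_real_derivative a' j t) (at t within {0..})) \<and>
               continuous_on {0..} (a' j)) \<and>
          (\<forall>j\<ge>1. \<forall>t\<ge>0. a' j t =
               lam (j - 1) powr (5/2) * (a (j - 1) t)\<^sup>2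
               - lam j powr (5/2) * a j t * a (j + 1) t) \<and>
          (\<forall>t\<ge>0. a 0 t = 0))"

definition positive_solution :: "(nat \<Rightarrow> real \<Rightarrow> real) \<Rightarrow> bool" where
  "positive_solution a \<longleftrightarrow> dyadic_solution a \<and> (\<forall>j. \<forall>t\<ge>0. a j t \<ge> 0)"

definition square_summable :: "(nat \<Rightarrow> real) \<Rightarrow> bool" where
  "square_summable x \<longleftrightarrow> summable (\<lambda>j. (x j)\<^sup>2)"

end

theory Submission
  imports Defs
begin

text \<open>Fix \<open>T > 0\<close>. The energy \<open>\<Sum>j. (a j s)\<^sup>2\<close> of a positive solution does not grow, so all components stay
below one constant \<open>E\<close>. The proof turns this flat bound into the decay \<open>2 powr (- 3 j / 5)\<close> at time \<open>T\<close>
by means of a moving envelope: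
\<open>a j s \<le> K * (r ^ j + \<tau> * m ^ j) ^ 12\<close> with \<open>\<tau> = 1 - s / T\<close>, where \<open>r ^ 12\<close> is just below
\<open>2 powr (- 3/5)\<close> and \<open>m\<close> is just above 1. At \<open>s = 0\<close> the envelope is at least \<open>K\<close>, hence above the
solution when \<open>K\<close> is large; at \<open>s = T\<close> the second summand has vanished and the claim is left. For
\<open>s < T\<close> the envelope tends to infinity with \<open>j\<close>, so it can only be touched at finitely many indices, and a
first-exit argument applies to the infinite system as it stands (\<open>tail_small\<close>, \<open>finite_barrier\<close>).

Let \<open>b j\<close> be the quotient of \<open>a j\<close> by the envelope. Then
\<open>b\<^sub>j' = \<xi>\<^sub>j b\<^sub>j + \<kappa>\<^sub>j (d\<^sub>j b\<^sub>j\<^sub>-\<^sub>1\<^sup>2 - b\<^sub>j b\<^sub>j\<^sub>+\<^sub>1)\<close>, where \<open>\<xi>\<^sub>j\<close> comes from the descent of the envelope. The rate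
\<open>\<kappa>\<^sub>j\<close> grows at least like \<open>K * 3.7 ^ j\<close>, while \<open>\<xi>\<^sub>j\<close> is at most \<open>(12 / T) (m / r) ^ j\<close>: the
envelope may come down in any prescribed time if \<open>K\<close> is large, and \<open>\<xi>\<close> is a small perturbation.

The bound \<open>b\<^sub>j \<le> 1\<close> is not preserved by itself: where \<open>b\<^sub>j = 1\<close>, the inflow \<open>d\<^sub>j b\<^sub>j\<^sub>-\<^sub>1\<^sup>2\<close> has to be beaten by
\<open>b\<^sub>j\<^sub>+\<^sub>1\<close>, so a large component must be followed by one that is not small. What is preserved is that
every pair \<open>(x, y) = (b\<^sub>j, b\<^sub>j\<^sub>+\<^sub>1)\<close> lies in a region with three edges: \<open>x \<le> 1\<close> on the right,
\<open>y \<ge> d\<^sub>j * profile x\<close> at the bottom, with \<open>profile 1\<close> slightly above 1, and \<open>y \<le> 5/8 x + 11/20\<close> along the diagonal.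
Each edge is guarded with the help of the others, applied to the same or a neighbouring pair. The
bottom edge keeps \<open>b\<^sub>j\<close> below 1 (\<open>right_edge\<close>). At the bottom edge \<open>y\<close> must rise, which
needs \<open>b\<^sub>j\<^sub>+\<^sub>2\<close> to be limited by the diagonal (\<open>bottom_edge\<close>). At the diagonal \<open>y\<close> must fall relative
to \<open>x\<close>, which needs \<open>b\<^sub>j\<^sub>+\<^sub>2\<close> to be above the bottom (\<open>diagonal_edge\<close>). At the last two edges the sign of a polynomial in one
variable decides, uniformly for all local slopes of the envelope between that of \<open>r\<close> and that of \<open>m\<close>.\<close>

section \<open>Three edges of an invariant region\<close>

text \<open>The zero at \<open>1/2\<close> makes the bottom edge void for small components, in particular at time 0 and at
high indices. The value \<open>51/50\<close> at 1 is the margin by which the right edge repels. The profile is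
even, so that the polynomial of the bottom edge is close to a quadratic one in \<open>x\<^sup>2\<close>.\<close>

definition profile :: "real \<Rightarrow> real" where
  "profile x = 17/50 * (4 * x\<^sup>2 - 1)"

lemma profile_mono: "0 \<le> x \<Longrightarrow> x \<le> y \<Longrightarrow> profile x \<le> profile y"
  unfolding profile_def by (simp add: power_mono)

lemma profile_le: "0 \<le> x \<Longrightarrow> x \<le> 1 \<Longrightarrow> profile x \<le> 51/50"
  using profile_mono[of x 1] by (simp add: profile_def)

lemma quadratic_concave_nonneg:
  fixes s :: real
  assumes "a \<le> s" "s \<le> b" "p \<le> 0" "p * a\<^sup>2 + q * a + r \<ge> 0" "p * b\<^sup>2 + q * b + r \<ge> 0"
  shows "p * s\<^sup>2 + q * s + r \<ge> 0"
proof (cases "a = b")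
  case True
  with assms show ?thesis by auto
next
  case False
  with assms have ab: "b - a > 0" by auto
  have "(b - a) * (p * s\<^sup>2 + q * s + r)
      = (b - s) * (p * a\<^sup>2 + q * a + r) + (s - a) * (p * b\<^sup>2 + q * b + r)
        + (- p) * ((s - a) * (b - s) * (b - a))"
    by (simp add: algebra_simps power2_eq_square)
  also have "\<dots> \<ge> 0"
  proof -
    have "(b - s) * (p * a\<^sup>2 + q * a + r) \<ge> 0" "(s - a) * (p * b\<^sup>2 + q * b + r) \<ge> 0"
      "(- p) * ((s - a) * (b - s) * (b - a)) \<ge> 0"
      using assms ab by (simp_all add: mult_nonneg_nonneg mult_nonpos_nonneg)
    thus ?thesis by linarith
  qed
  finally show ?thesis using ab by (simp add: zero_le_mult_iff)
qed

text \<open>The sign condition on the diagonal edge. The factor \<open>98/100\<close> stands for the square of the ratio of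
consecutive envelope values. The first inequality shows that smaller values of this ratio are worse,
and \<open>98/100\<close> is a lower bound for it. The cubic term is replaced by a quadratic minorant, and the remaining convex
quadratic by its chord, separately on two parts of the range of \<open>y\<close>.\<close>

lemma diagonal_poly:
  fixes x :: real
  assumes "0 \<le> x" "x \<le> 1"
  defines "y \<equiv> 5/8 * x + 11/20"
  assumes y1: "y \<le> 1"
  shows "x\<^sup>2 - y * profile y \<le> 0" "98/100 * (x\<^sup>2 - y * profile y) + 5/8 * x * y \<le> - 1/100"
proof -
  have x: "x = 8/5 * y - 22/25" by (simp add: y_def field_simps)
  have y0: "11/20 \<le> y" using assms by (simp add: y_def)
  \<comment> \<open>This quadratic minorant touches the cube at \<open>y = q\<close>; below, \<open>q\<close> is taken inside each part of the range.\<close>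
  have cube: "y^3 \<ge> 2 * q * y\<^sup>2 - q\<^sup>2 * y" for q
  proof -
    have "y * (y - q)\<^sup>2 \<ge> 0" using y0 by simp
    thus ?thesis by (simp add: algebra_simps power2_eq_square power3_eq_cube)
  qed
  have e: "98/100 * (x\<^sup>2 - y * profile y) + 5/8 * x * y
     = - (98/100*17/50*4) * y^3 + (98/100*64/25 + 1) * y\<^sup>2
       + (98/100*17/50 - 98/100*16/5*22/25 - 11/20) * y + 98/100*(22/25)\<^sup>2"
    unfolding profile_def by (simp add: x field_simps power2_eq_square power3_eq_cube)
  have chord: "y\<^sup>2 \<le> (p + q) * y - p * q" if "p \<le> y" "y \<le> q" for p q
  proof -
    have "(y - p) * (q - y) \<ge> 0" using that by simp
    thus ?thesis by (simp add: algebra_simps power2_eq_square)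
  qed
  show main: "98/100 * (x\<^sup>2 - y * profile y) + 5/8 * x * y \<le> - 1/100"
  proof (cases "y \<le> 3/4")
    case True
    show ?thesis unfolding e using cube[of "13/20"] chord[OF y0 True] True y0
      by (simp add: power_divide)
  next
    case False
    show ?thesis unfolding e using cube[of "9/10"] chord[of "3/4" 1] False y1
      by (simp add: power_divide)
  qed
  have "5/8 * x * y \<ge> 0" using assms(1) y0 by simp
  with main show "x\<^sup>2 - y * profile y \<le> 0" by argo
qed

text \<open>The sign condition on the bottom edge in the worst case, which is the steepest slope of the
envelope: the inflow coefficient is then largest, about \<open>617/1000\<close>, and the next component is least
faster, by the factor \<open>3729/1000\<close>. The factor \<open>988/1000\<close> allows for the drift of the inflow coefficient from
one index to the next. In the variable \<open>x\<^sup>2\<close> the only term that is not polynomial is \<open>x\<close>; its tangent at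
\<open>x = 73/100\<close> leaves concave quadratics, which are checked at the end points. The first inequality makes it possible to pass from
these extreme values to larger \<open>L\<close> and smaller \<open>d\<close>.\<close>

lemma bottom_poly:
  fixes x :: real
  assumes "1/2 \<le> x" "x \<le> 1"
  defines "k \<equiv> profile x"
  shows "1/50 \<le> 988/1000 * x\<^sup>2 - k * (11/20 + 5/8 * (617/1000) * k)" (is "_ \<le> ?A")
    and "617/1000 * (68/25 * (x - x\<^sup>2 * k)) + 1/100
      \<le> 3729/1000 * (988/1000 * x\<^sup>2 - k * (11/20 + 5/8 * (617/1000) * k))"
proof -
  define s where "s = x\<^sup>2"
  have s: "1/4 \<le> s" "s \<le> 1"
    using assms power_mono[of "1/2" x 2] power_mono[of x 1 2] by (auto simp: s_def power2_eq_square)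
  have k: "k = 17/50 * (4 * s - 1)" by (simp add: k_def profile_def s_def)
  have X: "x \<le> (s + (73/100)\<^sup>2) / (2 * (73/100))"
  proof -
    have "(x - 73/100)\<^sup>2 \<ge> 0" by simp
    thus ?thesis by (simp add: s_def power2_eq_square algebra_simps)
  qed
  let ?X = "(s + (73/100)\<^sup>2) / (2 * (73/100))"
  have "0 \<le> (- (17*17/2500*16*5/8*617/1000)) * s\<^sup>2 + (988/1000 - 17/50*4*11/20 + 17*17/2500*8*5/8*617/1000) * s
      + (17/50*11/20 - 17*17/2500*5/8*617/1000 - 1/50)"
    by (rule quadratic_concave_nonneg[OF s]) (auto simp: power2_eq_square)
  also have "\<dots> = ?A - 1/50" unfolding k s_def[symmetric] by (simp add: field_simps power2_eq_square)
  finally show "1/50 \<le> ?A" by simp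
  have *: "3729/1000 * (988/1000 * s - k * (11/20 + 5/8 * (617/1000) * k))
       - 617/1000 * (68/25 * (?X - s * k)) - 1/100
     = (- (3729/1000 * (17*17/2500*16*5/8*617/1000)) + 617/1000*68/25*17/50*4) * s\<^sup>2
       + (3729/1000 * (988/1000 - 17/50*4*11/20 + 17*17/2500*8*5/8*617/1000)
            - 617/1000*68/25*(50/73 + 17/50)) * s
       + (3729/1000 * (17/50*11/20 - 17*17/2500*5/8*617/1000) - 617/1000*68/25*73/200 - 1/100)"
    unfolding k by (simp add: field_simps power2_eq_square)
  have "\<dots> \<ge> 0"
    by (rule quadratic_concave_nonneg[OF s]) (auto simp: power2_eq_square)
  hence "617/1000 * (68/25 * (?X - s * k)) + 1/100 \<le> 3729/1000 * (988/1000 * s - k * (11/20 + 5/8 * (617/1000) * k))"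
    using * by linarith
  moreover have "x - s * k \<le> ?X - s * k" using X by simp
  ultimately show "617/1000 * (68/25 * (x - x\<^sup>2 * k)) + 1/100
      \<le> 3729/1000 * (988/1000 * x\<^sup>2 - k * (11/20 + 5/8 * (617/1000) * k))"
    unfolding s_def[symmetric] by argo
qed

text \<open>Here and in the next two lemmas \<open>w, x, y, z\<close> are four consecutive components, the velocities are
divided by the rate of \<open>x\<close>, \<open>L\<close> is the rate of \<open>y\<close> relative to that of \<open>x\<close>, and \<open>\<xi>\<close>, \<open>\<xi>'\<close>, \<open>\<zeta>\<close> are the
logarithmic drifts due to the moving envelope. The left-hand side is the velocity of
\<open>d * profile x\<close>, the right-hand side that of \<open>y\<close>. The diagonal bound on \<open>z\<close> limits the outflow of \<open>y\<close>.\<close>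

lemma bottom_edge:
  fixes x :: real
  assumes x: "0 \<le> x" "x \<le> 1" and y: "y = d * profile x" "0 \<le> y"
    and d: "0 < d" "d \<le> 617/1000" and L: "3729/1000 \<le> L" and d1: "988/1000 * d \<le> d1"
    and z: "z \<le> 5/8 * y + 11/20" and w: "0 \<le> w" "w \<le> 1"
    and xi: "0 \<le> \<xi>" "\<xi> \<le> 1/5000" "0 \<le> \<xi>'" "\<zeta> \<le> 2/5000"
  shows "d * \<zeta> * profile x + d * (68/25 * x) * (\<xi> * x + d * w\<^sup>2 - x * y)
      < \<xi>' * y + L * (d1 * x\<^sup>2 - y * z)"
proof -
  define k where "k = profile x"
  have k: "0 \<le> k" "k \<le> 51/50"
    using y d profile_le[OF x] by (auto simp: k_def zero_le_mult_iff)
  have "1/2 \<le> x"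
  proof (rule ccontr)
    assume "\<not> 1/2 \<le> x"
    hence "x\<^sup>2 < (1/2)\<^sup>2" using x by (intro power_strict_mono) auto
    thus False using k by (simp add: k_def profile_def power2_eq_square)
  qed
  define A where "A = 988/1000 * x\<^sup>2 - k * (11/20 + 5/8 * (617/1000) * k)"
  define T where "T = x - x\<^sup>2 * k"
  note bp = bottom_poly[OF \<open>1/2 \<le> x\<close> x(2), folded k_def, folded A_def T_def]
  have "x\<^sup>2 * (988/1000 * d) \<le> x\<^sup>2 * d1" using d1 by (intro mult_left_mono) auto
  moreover have "y * z \<le> y * (5/8 * y + 11/20)" using z y by (intro mult_left_mono) auto
  moreover have "d * k * (5/8 * (d * k)) \<le> d * k * (5/8 * (617/1000 * k))"
    using d k by (intro mult_left_mono mult_right_mono) auto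
  ultimately have 1: "d * A \<le> d1 * x\<^sup>2 - y * z"
    unfolding A_def y(1) k_def[symmetric] by (simp add: algebra_simps power2_eq_square)
  have 2: "d * (3729/1000 * A) \<le> L * (d1 * x\<^sup>2 - y * z)"
  proof -
    have "3729/1000 * (d * A) \<le> L * (d * A)" using L d bp by (intro mult_right_mono) auto
    also have "\<dots> \<le> L * (d1 * x\<^sup>2 - y * z)" using 1 L by (intro mult_left_mono) auto
    finally show ?thesis by simp
  qed
  \<comment> \<open>The left-hand side is affine in \<open>d\<close>, but its slope \<open>T\<close> is negative for \<open>x\<close> near 1.\<close>
  have dT: "68/25 * (d * T) + 1/100 \<le> 3729/1000 * A"
  proof (cases "T \<ge> 0")
    case True
    hence "d * T \<le> 617/1000 * T" using d by (intro mult_right_mono) auto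
    thus ?thesis using bp by argo
  next
    case False
    hence "d * T \<le> 0" using d by (simp add: mult_le_0_iff)
    thus ?thesis using bp by argo
  qed
  have "\<zeta> * k \<le> 2/5000 * (51/50)"
  proof -
    have "\<zeta> * k \<le> 2/5000 * k" using xi k by (intro mult_right_mono) auto
    thus ?thesis using k by simp
  qed
  moreover have "x * (\<xi> * x + d * w\<^sup>2 - x * y) \<le> 1/5000 + d * T"
  proof -
    have "\<xi> * x\<^sup>2 \<le> 1/5000 * 1" using xi x by (intro mult_mono) (auto simp: power_le_one)
    moreover have "x * d * w\<^sup>2 \<le> x * d * 1" using x d w by (intro mult_left_mono) (auto simp: power_le_one)
    ultimately show ?thesis unfolding T_def y(1) k_def[symmetric]
      by (simp add: algebra_simps power2_eq_square)
  qed
  ultimately have "\<zeta> * k + 68/25 * (x * (\<xi> * x + d * w\<^sup>2 - x * y)) < 3729/1000 * A"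
    using dT by linarith
  hence "d * (\<zeta> * k + 68/25 * (x * (\<xi> * x + d * w\<^sup>2 - x * y))) < d * (3729/1000 * A)"
    using d by simp
  also note 2
  also have "L * (d1 * x\<^sup>2 - y * z) \<le> \<xi>' * y + L * (d1 * x\<^sup>2 - y * z)" using xi y by simp
  finally show ?thesis by (simp only: k_def distrib_left mult_ac)
qed

text \<open>The bottom bound on \<open>z\<close> provides an outflow from \<open>y\<close> that exceeds the inflow. The rise of \<open>x\<close> by its own inflow only
helps, so the term with \<open>w\<close> is dropped.\<close>

lemma diagonal_edge:
  fixes x :: real
  assumes x: "0 \<le> x" "x \<le> 1" and y: "y = 5/8 * x + 11/20" "y \<le> 1"
    and d: "0 \<le> d" and L: "0 \<le> L" "98/100 \<le> L * d1" and z: "d1 * profile y \<le> z"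
    and xi: "0 \<le> \<xi>" "\<xi>' \<le> 1/5000"
  shows "\<xi>' * y + L * (d1 * x\<^sup>2 - y * z) - 5/8 * (\<xi> * x + d * w\<^sup>2 - x * y) < 0"
proof -
  have y0: "0 \<le> y" using x y by simp
  note dp = diagonal_poly[OF x, folded y(1), OF y(2)]
  have "L * y * (d1 * profile y) \<le> L * y * z" using z L y0 by (intro mult_left_mono) auto
  hence "L * (d1 * x\<^sup>2 - y * z) \<le> (L * d1) * (x\<^sup>2 - y * profile y)"
    by (simp add: algebra_simps)
  also have "\<dots> \<le> 98/100 * (x\<^sup>2 - y * profile y)" using L dp by (intro mult_right_mono_neg) auto
  finally have "L * (d1 * x\<^sup>2 - y * z) + 5/8 * x * y \<le> - 1/100" using dp by linarith
  moreover have "\<xi>' * y \<le> 1/5000"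
  proof -
    have "\<xi>' * y \<le> 1/5000 * y" using xi y0 by (intro mult_right_mono) auto
    thus ?thesis using y(2) by simp
  qed
  moreover have "0 \<le> \<xi> * x + d * w\<^sup>2" using xi x d by simp
  ultimately show ?thesis by (simp add: algebra_simps)
qed

text \<open>The excess \<open>1/50\<close> of \<open>profile 1\<close> over 1, multiplied by the lower bound for \<open>d\<close>, outweighs the drift.\<close>

lemma right_edge:
  fixes d :: real
  assumes "17/100 \<le> d" "d * profile 1 \<le> y" "0 \<le> w" "w \<le> 1" "\<xi> \<le> 1/5000"
  shows "\<xi> + d * w\<^sup>2 - y < 0"
proof -
  have "d * w\<^sup>2 \<le> d * 1" using assms by (intro mult_left_mono) (auto simp: power_le_one)
  moreover have "51/50 * d \<le> y" using assms(2) by (simp add: profile_def)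
  ultimately show ?thesis using assms(1,5) by linarith
qed

section \<open>The moving envelope\<close>

definition growth :: real where "growth = 2 powr (5/2)"

lemma growth_bounds: "5656/1000 < growth" "growth < 5657/1000"
proof -
  have sq: "growth\<^sup>2 = 32" and pos: "growth > 0"
    by (simp_all add: growth_def powr_power)
  show "5656/1000 < growth"
    by (rule power_less_imp_less_base[of _ 2]) (use sq pos in \<open>auto simp: power2_eq_square\<close>)
  show "growth < 5657/1000"
    by (rule power_less_imp_less_base[of _ 2]) (use sq pos in \<open>auto simp: power2_eq_square\<close>)
qed

lemma lam_powr: "lam j powr (5/2) = growth ^ j"
  by (simp add: lam_def growth_def powr_powr mult.commute flip: powr_realpow)

text \<open>The base \<open>9659/10000\<close> has a twelfth power just below \<open>2 powr (- 3/5)\<close> (see \<open>ratio_powr\<close>). The argument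
\<open>\<tau>\<close> is the fraction of time that is left.\<close>

definition env_root :: "real \<Rightarrow> nat \<Rightarrow> real" where
  "env_root \<tau> j = (9659/10000) ^ j + \<tau> * (10007/10000) ^ j"

text \<open>Taking a sum of two roots and then its twelfth power, rather than the sum of the powers, spreads the change of slope over
many indices. Neighbouring ratios are then almost equal (\<open>env_almost_log_concave\<close>), as the
bottom edge requires.\<close>

definition env :: "real \<Rightarrow> nat \<Rightarrow> real" where
  "env \<tau> j = env_root \<tau> j ^ 12"

lemma env_root_pos: "0 \<le> \<tau> \<Longrightarrow> 0 < env_root \<tau> j"
  by (simp add: env_root_def add_pos_nonneg)

lemma env_pos: "0 \<le> \<tau> \<Longrightarrow> 0 < env \<tau> j"
  unfolding env_def by (intro zero_less_power env_root_pos)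

lemma env_le_Suc:
  assumes "0 \<le> \<tau>" shows "env \<tau> j \<le> 15165/10000 * env \<tau> (Suc j)"
proof -
  have "env_root \<tau> j \<le> 10000/9659 * env_root \<tau> (Suc j)"
    using assms by (simp add: env_root_def algebra_simps)
  hence "env \<tau> j \<le> (10000/9659 * env_root \<tau> (Suc j)) ^ 12"
    unfolding env_def using assms env_root_pos by (intro power_mono) (auto simp: less_imp_le)
  also have "\<dots> = (10000/9659) ^ 12 * env \<tau> (Suc j)" by (simp only: power_mult_distrib env_def)
  also have "\<dots> \<le> 15165/10000 * env \<tau> (Suc j)"
    using env_pos[OF assms, of "Suc j"] by (intro mult_right_mono) (simp_all add: power_divide)
  finally show ?thesis .
qed

lemma env_Suc_le:
  assumes "0 \<le> \<tau>" shows "env \<tau> (Suc j) \<le> 10085/10000 * env \<tau> j"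
proof -
  have "env_root \<tau> (Suc j) \<le> 10007/10000 * env_root \<tau> j"
    using assms by (simp add: env_root_def algebra_simps)
  hence "env \<tau> (Suc j) \<le> (10007/10000 * env_root \<tau> j) ^ 12"
    unfolding env_def using assms env_root_pos by (intro power_mono) (auto simp: less_imp_le)
  also have "\<dots> = (10007/10000) ^ 12 * env \<tau> j" by (simp only: power_mult_distrib env_def)
  also have "\<dots> \<le> 10085/10000 * env \<tau> j"
    using env_pos[OF assms, of j] by (intro mult_right_mono) (simp_all add: power_divide)
  finally show ?thesis .
qed

text \<open>For a sum \<open>q\<close> of two geometric sequences with ratios \<open>r\<close> and \<open>m\<close>, the quotient
\<open>q\<^sub>j\<^sub>+\<^sub>1\<^sup>2 / (q\<^sub>j q\<^sub>j\<^sub>+\<^sub>2)\<close> is at least \<open>4 r m / (r + m)\<^sup>2\<close>: cleared of denominators, the difference of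
the two sides is a square. The constant is a lower bound for the twelfth power of this value.\<close>

lemma env_almost_log_concave:
  assumes "0 \<le> \<tau>"
  shows "9962/10000 * (env \<tau> j * env \<tau> (Suc (Suc j))) \<le> (env \<tau> (Suc j))\<^sup>2"
proof -
  define r m :: real where "r = 9659/10000" and "m = 10007/10000"
  define X Y where "X = r ^ j" and "Y = \<tau> * m ^ j"
  have e: "env_root \<tau> j = X + Y" "env_root \<tau> (Suc j) = r * X + m * Y"
    "env_root \<tau> (Suc (Suc j)) = r\<^sup>2 * X + m\<^sup>2 * Y"
    by (simp_all add: env_root_def X_def Y_def r_def m_def power2_eq_square)
  have "(r + m)\<^sup>2 * (r * X + m * Y)\<^sup>2 - 4 * r * m * ((X + Y) * (r\<^sup>2 * X + m\<^sup>2 * Y))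
      = ((r - m) * (r * X - m * Y))\<^sup>2"
    by (simp add: algebra_simps power2_eq_square)
  hence "4 * r * m * ((X + Y) * (r\<^sup>2 * X + m\<^sup>2 * Y)) \<le> (r + m)\<^sup>2 * (r * X + m * Y)\<^sup>2"
    using zero_le_power2[of "(r - m) * (r * X - m * Y)"] by linarith
  hence "4 * r * m / (r + m)\<^sup>2 * (env_root \<tau> j * env_root \<tau> (Suc (Suc j))) \<le> (env_root \<tau> (Suc j))\<^sup>2"
    unfolding e[symmetric] by (simp add: r_def m_def field_simps)
  hence "(4 * r * m / (r + m)\<^sup>2 * (env_root \<tau> j * env_root \<tau> (Suc (Suc j)))) ^ 12
      \<le> ((env_root \<tau> (Suc j))\<^sup>2) ^ 12"
    using env_root_pos[OF assms, of j] env_root_pos[OF assms, of "Suc (Suc j)"]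
    by (intro power_mono) (auto simp: r_def m_def)
  hence "(4 * r * m / (r + m)\<^sup>2) ^ 12 * (env \<tau> j * env \<tau> (Suc (Suc j))) \<le> (env \<tau> (Suc j))\<^sup>2"
    unfolding env_def power_mult_distrib power_mult[symmetric] by (simp add: mult.commute)
  moreover have "9962/10000 \<le> (4 * r * m / (r + m)\<^sup>2) ^ 12"
    by (simp add: r_def m_def power_divide)
  hence "9962/10000 * (env \<tau> j * env \<tau> (Suc (Suc j)))
      \<le> (4 * r * m / (r + m)\<^sup>2) ^ 12 * (env \<tau> j * env \<tau> (Suc (Suc j)))"
    using env_pos[OF assms, of j] env_pos[OF assms, of "Suc (Suc j)"] by (intro mult_right_mono) auto
  ultimately show ?thesis by linarith
qed

text \<open>The coefficient of \<open>b\<^sub>i\<^sup>2\<close> in the equation for \<open>b\<^sub>i\<^sub>+\<^sub>1\<close>, relative to that of \<open>b\<^sub>i\<^sub>+\<^sub>1 b\<^sub>i\<^sub>+\<^sub>2\<close>.\<close>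

definition inflow :: "real \<Rightarrow> nat \<Rightarrow> real" where
  "inflow \<tau> i = (env \<tau> i)\<^sup>2 / (growth * env \<tau> (Suc i) * env \<tau> (Suc (Suc i)))"

lemma inflow_bounds:
  assumes "0 \<le> \<tau>"
  shows "inflow \<tau> i \<le> 617/1000" "17/100 \<le> inflow \<tau> i"
proof -
  note pos = env_pos[OF assms]
  let ?p = "env \<tau> i" and ?q = "env \<tau> (Suc i)" and ?r = "env \<tau> (Suc (Suc i))"
  have den: "growth * ?q * ?r > 0" using pos growth_bounds by simp
  have "?p * ?p \<le> (15165/10000 * ?q) * (15165/10000 * (15165/10000 * ?r))"
    using env_le_Suc[OF assms, of i] env_le_Suc[OF assms, of "Suc i"] pos[THEN less_imp_le]
    by (intro mult_mono order_trans[OF env_le_Suc[OF assms, of i]] mult_left_mono) auto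
  also have "\<dots> \<le> 617/1000 * (5656/1000 * (?q * ?r))"
    using mult_pos_pos[OF pos[of "Suc i"] pos[of "Suc (Suc i)"]] by simp
  also have "\<dots> \<le> 617/1000 * (growth * (?q * ?r))"
    using growth_bounds pos[THEN less_imp_le] by (intro mult_left_mono mult_right_mono) auto
  finally show "inflow \<tau> i \<le> 617/1000"
    using den unfolding inflow_def by (subst pos_divide_le_eq) (auto simp: power2_eq_square mult_ac)
  have "17/100 * (growth * (?q * ?r)) \<le> 17/100 * (5657/1000 * (?q * ?r))"
    using growth_bounds pos[THEN less_imp_le] by (intro mult_left_mono mult_right_mono) auto
  also have "\<dots> \<le> 17/100 * (5657/1000 * ((10085/10000 * ?p) * (10085/10000 * (10085/10000 * ?p))))"
    using env_Suc_le[OF assms, of i] env_Suc_le[OF assms, of "Suc i"] pos[THEN less_imp_le]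
    by (intro mult_left_mono mult_mono order_trans[OF env_Suc_le[OF assms, of "Suc i"]]) auto
  also have "\<dots> \<le> ?p * ?p"
    using mult_pos_pos[OF pos[of i] pos[of i]] by simp
  finally show "17/100 \<le> inflow \<tau> i"
    using den unfolding inflow_def by (subst pos_le_divide_eq) (auto simp: power2_eq_square mult_ac)
qed

text \<open>The quotient of the two coefficients is a product of three factors of the form
\<open>P\<^sub>j\<^sub>+\<^sub>1\<^sup>2 / (P\<^sub>j P\<^sub>j\<^sub>+\<^sub>2)\<close> with the envelope \<open>P\<close>, and each of them is close to 1.\<close>

lemma inflow_slowly_varying:
  assumes "0 \<le> \<tau>"
  shows "988/1000 * inflow \<tau> i \<le> inflow \<tau> (Suc i)"
proof -
  note pos = env_pos[OF assms]
  define p where "p = env \<tau> i"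
  define q where "q = env \<tau> (Suc i)"
  define r where "r = env \<tau> (Suc (Suc i))"
  define s where "s = env \<tau> (Suc (Suc (Suc i)))"
  have P: "p > 0" "q > 0" "r > 0" "s > 0" using pos by (auto simp: p_def q_def r_def s_def)
  let ?h = "9962/10000 :: real"
  have 1: "?h * (p * r) \<le> q\<^sup>2" "?h * (q * s) \<le> r\<^sup>2"
    using env_almost_log_concave[OF assms, of i] env_almost_log_concave[OF assms, of "Suc i"]
    by (simp_all add: p_def q_def r_def s_def)
  have "(?h * p)\<^sup>2 * (?h * (q * s)) \<le> (?h * p)\<^sup>2 * r\<^sup>2"
    using 1 by (intro mult_left_mono) auto
  also have "\<dots> = (?h * (p * r))\<^sup>2" by (simp add: power_mult_distrib power_divide mult_ac)
  also have "\<dots> \<le> (q\<^sup>2)\<^sup>2" using 1 P by (intro power_mono) auto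
  finally have "?h ^ 3 * (p\<^sup>2 * s) * q \<le> q ^ 3 * q"
    by (simp add: power2_eq_square power3_eq_cube mult_ac)
  hence "?h ^ 3 * (p\<^sup>2 * s) \<le> q ^ 3" using P by simp
  moreover have "988/1000 * (p\<^sup>2 * s) \<le> ?h ^ 3 * (p\<^sup>2 * s)"
    using P by (intro mult_right_mono) (auto simp: power_divide)
  ultimately have "988/1000 * (p\<^sup>2 * s) \<le> q ^ 3" by linarith
  hence "988/1000 * p\<^sup>2 / (q * r) \<le> q\<^sup>2 / (r * s)"
    using P by (simp add: field_simps power2_eq_square power3_eq_cube)
  hence "(988/1000 * p\<^sup>2 / (q * r)) / growth \<le> (q\<^sup>2 / (r * s)) / growth"
    using growth_bounds by (intro divide_right_mono) auto
  thus ?thesis by (simp add: inflow_def p_def q_def r_def s_def mult_ac)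
qed

section \<open>First exit through finitely many barriers\<close>

text \<open>At the first time at which some barrier function reaches 0, the others are still at most 0, and a
negative derivative contradicts that this function was negative just before.\<close>

lemma finite_barrier:
  fixes \<Phi> :: "(real \<Rightarrow> real) set"
  assumes fin: "finite \<Phi>"
    and cont: "\<And>f. f \<in> \<Phi> \<Longrightarrow> continuous_on {0..T} f"
    and init: "\<And>f. f \<in> \<Phi> \<Longrightarrow> f 0 < 0"
    and inward: "\<And>f s. f \<in> \<Phi> \<Longrightarrow> 0 < s \<Longrightarrow> s \<le> T \<Longrightarrow> (\<And>g. g \<in> \<Phi> \<Longrightarrow> g s \<le> 0) \<Longrightarrow> f s = 0
      \<Longrightarrow> \<exists>D<0. (f has_real_derivative D) (at s)"
    and f: "f \<in> \<Phi>" and s: "0 \<le> s" "s \<le> T"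
  shows "f s < 0"
proof (rule ccontr)
  assume neg: "\<not> f s < 0"
  define S where "S = (\<Union>g\<in>\<Phi>. {s\<in>{0..T}. 0 \<le> g s})"
  have "closed S" unfolding S_def
  proof (rule closed_UN[OF fin], safe)
    fix g assume g: "g \<in> \<Phi>"
    show "closed {s \<in> {0..T}. 0 \<le> g s}"
      using continuous_on_closed_Collect_le[OF continuous_on_const cont[OF g], of 0] by simp
  qed
  moreover have "s \<in> S" using f s neg by (force simp: S_def not_less)
  moreover have bdd: "bdd_below S" by (rule bdd_belowI[of _ 0]) (auto simp: S_def)
  ultimately have IS: "Inf S \<in> S" by (intro closed_contains_Inf) auto
  define u where "u = Inf S"
  from IS obtain g where g: "g \<in> \<Phi>" "0 \<le> u" "u \<le> T" "0 \<le> g u" by (auto simp: S_def u_def)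
  have before: "h v < 0" if "h \<in> \<Phi>" "0 \<le> v" "v < u" for h v
  proof (rule ccontr)
    assume "\<not> h v < 0"
    hence "v \<in> S" using that g by (force simp: S_def not_less)
    hence "u \<le> v" unfolding u_def using bdd by (rule cInf_lower)
    thus False using that by simp
  qed
  have "u \<noteq> 0" using init[OF g(1)] g(4) by auto
  hence u: "0 < u" using g by simp
  have le: "h u \<le> 0" if h: "h \<in> \<Phi>" for h
  proof -
    have "continuous_on {0..u} h" using cont[OF h] by (rule continuous_on_subset) (use g in auto)
    moreover have "closure {0..<u} = {0..u}" using u by simp
    moreover have "h v \<le> 0" if "v \<in> {0..<u}" for v using before[OF h] that by (simp add: less_imp_le)
    ultimately show ?thesis
      using continuous_le_on_closure[of "{0..<u}" h u 0] u by auto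
  qed
  have "g u = 0" using le[OF g(1)] g(4) by simp
  then obtain D where D: "D < 0" "(g has_real_derivative D) (at u)"
    using inward[OF g(1) u g(3)] le by blast
  then obtain e where e: "e > 0" "\<And>h. 0 < h \<Longrightarrow> h < e \<Longrightarrow> g u < g (u - h)"
    using DERIV_neg_dec_left[of g D u] by auto
  define h where "h = min (e/2) (u/2)"
  have "g u < g (u - h)" "g (u - h) < 0"
    using e u before[OF g(1), of "u - h"] by (auto simp: h_def min_def)
  thus False using \<open>g u = 0\<close> by simp
qed

lemma derivative_on_half_line:
  assumes "(f has_real_derivative D) (at s within {0..})" "0 < s"
  shows "(f has_real_derivative D) (at s)"
  using assms at_within_interior[of s "{0..}"] by simp

section \<open>Energy\<close>

text \<open>The equations telescope: the energy of the first \<open>n\<close> components changes only by the flux into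
component \<open>n + 1\<close>, which has a sign for a positive solution.\<close>

lemma energy_bound:
  fixes a :: "nat \<Rightarrow> real \<Rightarrow> real"
  assumes pos: "\<And>j s. 0 \<le> s \<Longrightarrow> 0 \<le> a j s" and zero: "\<And>s. 0 \<le> s \<Longrightarrow> a 0 s = 0"
    and deriv: "\<And>j s. 0 \<le> s \<Longrightarrow> (a (Suc j) has_real_derivative
      growth ^ j * (a j s)\<^sup>2 - growth ^ Suc j * a (Suc j) s * a (Suc (Suc j)) s) (at s within {0..})"
    and summ: "summable (\<lambda>j. (a j 0)\<^sup>2)" and s: "0 \<le> s"
  shows "(a j s)\<^sup>2 \<le> (\<Sum>j. (a j 0)\<^sup>2)"
proof -
  define En where "En = (\<lambda>n s. \<Sum>i<n. (a (Suc i) s)\<^sup>2)"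
  have dE: "(En n has_real_derivative - 2 * growth ^ n * (a n s)\<^sup>2 * a (Suc n) s) (at s within {0..})"
    if "0 \<le> s" for n s
  proof (induction n)
    case 0
    show ?case using zero[OF that] by (simp add: En_def)
  next
    case (Suc n)
    have "((\<lambda>s. En n s + (a (Suc n) s)\<^sup>2) has_real_derivative
        - 2 * growth ^ n * (a n s)\<^sup>2 * a (Suc n) s + 2 * a (Suc n) s *
          (growth ^ n * (a n s)\<^sup>2 - growth ^ Suc n * a (Suc n) s * a (Suc (Suc n)) s)) (at s within {0..})"
      by (rule derivative_eq_intros Suc deriv[OF that] refl | simp)+
    thus ?case by (simp add: En_def algebra_simps power2_eq_square)
  qed
  have mono: "En n s \<le> En n 0" for n
  proof (cases "s = 0")
    case False
    have c: "continuous_on {0..s} (En n)"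
      by (rule DERIV_continuous_on[where D="\<lambda>s. - 2 * growth ^ n * (a n s)\<^sup>2 * a (Suc n) s"])
         (rule DERIV_subset[OF dE], auto)
    show ?thesis
    proof (rule DERIV_nonpos_imp_decreasing_open[OF s _ c])
      fix x assume "0 < x" "x < s"
      thus "\<exists>y. (En n has_real_derivative y) (at x) \<and> y \<le> 0"
        using derivative_on_half_line[OF dE, of x] pos[of x] growth_bounds
        by (intro exI[of _ "- 2 * growth ^ n * (a n x)\<^sup>2 * a (Suc n) x"]) auto
    qed
  qed simp
  show ?thesis
  proof (cases j)
    case 0
    thus ?thesis using zero[OF s] suminf_nonneg[OF summ] by simp
  next
    case (Suc i)
    have "(a j s)\<^sup>2 \<le> En (Suc i) s"
      unfolding En_def Suc using member_le_sum[of i "{..<Suc i}" "\<lambda>i. (a (Suc i) s)\<^sup>2"] by auto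
    also have "\<dots> \<le> En (Suc i) 0" by (rule mono)
    also have "\<dots> = (\<Sum>k\<in>Suc ` {..<Suc i}. (a k 0)\<^sup>2)"
      unfolding En_def by (subst sum.reindex) auto
    also have "\<dots> \<le> (\<Sum>j. (a j 0)\<^sup>2)"
      by (rule sum_le_suminf[OF summ]) auto
    finally show ?thesis .
  qed
qed

section \<open>Descent of the envelope\<close>

definition env_log_deriv :: "real \<Rightarrow> nat \<Rightarrow> real" where
  "env_log_deriv \<tau> j = 12 * (10007/10000) ^ j / env_root \<tau> j"

lemma env_has_derivative:
  assumes "0 \<le> \<tau>"
  shows "((\<lambda>\<tau>. env \<tau> j) has_real_derivative env_log_deriv \<tau> j * env \<tau> j) (at \<tau>)"
proof -
  have "((\<lambda>\<tau>. env \<tau> j) has_real_derivative 12 * env_root \<tau> j ^ 11 * (10007/10000) ^ j) (at \<tau>)"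
    unfolding env_def env_root_def by (auto intro!: derivative_eq_intros)
  moreover have "12 * env_root \<tau> j ^ 11 * (10007/10000) ^ j = env_log_deriv \<tau> j * env \<tau> j"
  proof -
    have "env \<tau> j = env_root \<tau> j * env_root \<tau> j ^ 11"
      unfolding env_def by (simp flip: power_Suc)
    thus ?thesis using env_root_pos[OF assms, of j] by (simp add: env_log_deriv_def field_simps)
  qed
  ultimately show ?thesis by simp
qed

lemma env_log_deriv_nonneg: "0 \<le> \<tau> \<Longrightarrow> 0 \<le> env_log_deriv \<tau> j"
  using env_root_pos[of \<tau> j] by (simp add: env_log_deriv_def)

text \<open>The logarithmic velocity of the envelope grows at most like the powers of \<open>m / r < 1.04\<close>, the rate of the
system at least like those of \<open>growth * r ^ 12 > 3.7\<close>. This is why an envelope that descends at unit speed in \<open>\<tau>\<close>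
is a small perturbation at all indices.\<close>

lemma env_log_deriv_le:
  assumes "0 \<le> \<tau>" "i \<le> Suc j"
  shows "env_log_deriv \<tau> i \<le> 20 * (growth ^ j * env \<tau> (Suc j))"
proof -
  let ?r = "9659/10000 :: real" and ?m = "10007/10000 :: real"
  have alg: "r ^ 12 * (g * r ^ 12) ^ j = g ^ j * (r ^ Suc j) ^ 12" for r g :: real
    by (simp add: power_mult_distrib mult_ac flip: power_mult)
  have "env_log_deriv \<tau> i \<le> 12 * ?m ^ i / ?r ^ i"
    unfolding env_log_deriv_def env_root_def using assms
    by (intro divide_left_mono mult_nonneg_nonneg mult_pos_pos add_pos_nonneg) auto
  also have "\<dots> = 12 * (?m / ?r) ^ i" by (simp add: power_divide)
  also have "\<dots> \<le> 12 * (?m / ?r) ^ Suc j"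
    using assms by (intro mult_left_mono power_increasing) auto
  also have "\<dots> \<le> 12 * (104/100) ^ Suc j"
    by (intro mult_left_mono power_mono) auto
  also have "\<dots> \<le> 13 * (104/100) ^ j" by simp
  also have "\<dots> \<le> 13 * (5656/1000 * ?r ^ 12) ^ j"
    by (intro mult_left_mono power_mono) (simp_all add: power_divide)
  also have "\<dots> \<le> (20 * ?r ^ 12) * (5656/1000 * ?r ^ 12) ^ j"
    by (intro mult_right_mono) (simp_all add: power_divide)
  also have "\<dots> = 20 * ((5656/1000) ^ j * (?r ^ Suc j) ^ 12)"
    using alg[of ?r "5656/1000"] by simp
  also have "\<dots> \<le> 20 * (growth ^ j * env \<tau> (Suc j))"
    unfolding env_def env_root_def using assms growth_bounds
    by (intro mult_left_mono mult_mono power_mono) auto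
  finally show ?thesis .
qed

lemma env_ge_at_start: "1 \<le> env 1 j"
proof -
  have "(1::real) \<le> (10007/10000) ^ j" by (rule one_le_power) simp
  hence "1 \<le> env_root 1 j" by (simp add: env_root_def add_increasing)
  thus ?thesis unfolding env_def by (rule one_le_power)
qed

text \<open>Together with a flat bound on the solution, this makes the quotients tend to 0 in the index, uniformly as long as \<open>\<tau>\<close> is
bounded away from 0.\<close>

lemma env_unbounded:
  assumes "0 < \<tau>'" "\<tau>' \<le> \<tau>"
  shows "\<tau>' ^ 12 * (10007/10000) ^ j \<le> env \<tau> j"
proof -
  have "(10007/10000::real) ^ j * 1 \<le> (10007/10000) ^ j * ((10007/10000) ^ j) ^ 11"
    by (intro mult_left_mono one_le_power) auto
  hence "\<tau>' ^ 12 * (10007/10000) ^ j \<le> \<tau>' ^ 12 * ((10007/10000) ^ j) ^ 12"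
    using assms by (intro mult_left_mono) (auto simp flip: power_Suc)
  also have "\<dots> = (\<tau>' * (10007/10000) ^ j) ^ 12" by (simp only: power_mult_distrib)
  also have "\<dots> \<le> env \<tau> j"
    unfolding env_def env_root_def using assms
    by (intro power_mono) (auto intro!: add_increasing mult_right_mono)
  finally show ?thesis .
qed

section \<open>The solution relative to the envelope\<close>

text \<open>A positive solution with a flat bound \<open>E\<close>, and an envelope of amplitude \<open>K\<close> that comes down in time \<open>T\<close>. The
first condition on \<open>K\<close> makes the drifts at most \<open>1/5000\<close> of the rates, the second puts the initial quotients
below \<open>1/4\<close>.\<close>

locale cascade =
  fixes a :: "nat \<Rightarrow> real \<Rightarrow> real" and E K T :: real
  assumes nonneg: "0 \<le> s \<Longrightarrow> 0 \<le> a j s"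
    and boundary: "0 \<le> s \<Longrightarrow> a 0 s = 0"
    and evolution: "0 \<le> s \<Longrightarrow> (a (Suc i) has_real_derivative
      growth ^ i * (a i s)\<^sup>2 - growth ^ Suc i * a (Suc i) s * a (Suc (Suc i)) s) (at s within {0..})"
    and bounded: "0 \<le> s \<Longrightarrow> a j s \<le> E"
    and T: "0 < T" and K: "100000 / T \<le> K" "4 * E \<le> K"
begin

definition P :: "nat \<Rightarrow> real \<Rightarrow> real" where "P j s = env (1 - s / T) j"
definition b :: "nat \<Rightarrow> real \<Rightarrow> real" where "b j s = a j s / (K * P j s)"
definition d :: "nat \<Rightarrow> real \<Rightarrow> real" where "d i s = inflow (1 - s / T) i"
definition \<xi> :: "nat \<Rightarrow> real \<Rightarrow> real" where "\<xi> j s = env_log_deriv (1 - s / T) j / T"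
definition speed :: "nat \<Rightarrow> real \<Rightarrow> real" where
  "speed i s = K * growth ^ Suc i * P (Suc (Suc i)) s"

lemma K_pos: "0 < K"
  using T K(1) by (smt (verit) divide_pos_pos)

lemma clock_nonneg: "s \<le> T \<Longrightarrow> 0 \<le> 1 - s / T"
  using T by simp

lemma P_pos: "s \<le> T \<Longrightarrow> 0 < P j s"
  unfolding P_def by (intro env_pos clock_nonneg)

lemma speed_pos: "s \<le> T \<Longrightarrow> 0 < speed i s"
  unfolding speed_def using growth_bounds P_pos K_pos by simp

lemma b_nonneg: "0 \<le> s \<Longrightarrow> s \<le> T \<Longrightarrow> 0 \<le> b j s"
  unfolding b_def using nonneg P_pos K_pos by (simp add: less_imp_le)

lemma P_deriv: "s \<le> T \<Longrightarrow> (P j has_real_derivative - (\<xi> j s * P j s)) (at s)"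
proof -
  assume "s \<le> T"
  hence "(P j has_real_derivative env_log_deriv (1 - s / T) j * env (1 - s / T) j * (- (1 / T))) (at s)"
    unfolding P_def
    by (intro DERIV_chain2[OF env_has_derivative] clock_nonneg)
       (use T in \<open>auto intro!: derivative_eq_intros\<close>)
  thus ?thesis by (simp add: \<xi>_def P_def)
qed

lemma b_deriv:
  assumes s: "0 < s" "s \<le> T"
  shows "(b (Suc i) has_real_derivative
     speed i s * (\<xi> (Suc i) s / speed i s * b (Suc i) s + d i s * (b i s)\<^sup>2 - b (Suc i) s * b (Suc (Suc i)) s))
     (at s)"
proof -
  have pos: "0 < P i s" "0 < P (Suc i) s" "0 < P (Suc (Suc i)) s" "0 < growth" "0 < K"
    using P_pos s growth_bounds K_pos by auto
  have 1: "(a (Suc i) has_real_derivative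
      growth ^ i * (a i s)\<^sup>2 - growth ^ Suc i * a (Suc i) s * a (Suc (Suc i)) s) (at s)"
    using derivative_on_half_line[OF evolution] s by simp
  have 2: "((\<lambda>s. K * P (Suc i) s) has_real_derivative K * - (\<xi> (Suc i) s * P (Suc i) s)) (at s)"
    using s by (intro DERIV_cmult P_deriv)
  \<comment> \<open>The quotient rule, rewritten in terms of the quotients themselves.\<close>
  have alg: "((G * A\<^sup>2 - g * G * B * C) * (k * q) - B * (k * - (l * q))) / ((k * q) * (k * q))
      = (k * (g * G) * r) * (l / (k * (g * G) * r) * (B / (k * q)) + p\<^sup>2 / (g * q * r) * (A / (k * p))\<^sup>2
         - B / (k * q) * (C / (k * r)))"
    if "0 < G" "0 < g" "0 < k" "0 < p" "0 < q" "0 < r" for G g k p q r l A B C :: real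
    using that by (simp add: field_simps power2_eq_square)
  have dd: "d i s = (P i s)\<^sup>2 / (growth * P (Suc i) s * P (Suc (Suc i)) s)"
    by (simp add: d_def inflow_def P_def)
  show ?thesis
    unfolding b_def[abs_def]
    using DERIV_divide[OF 1 2] pos
      alg[of "growth ^ i" growth K "P i s" "P (Suc i) s" "P (Suc (Suc i)) s" "a i s"]
    unfolding dd speed_def power_Suc by simp
qed

lemma d_deriv:
  assumes s: "s \<le> T"
  shows "(d i has_real_derivative d i s * (\<xi> (Suc i) s + \<xi> (Suc (Suc i)) s - 2 * \<xi> i s)) (at s)"
proof -
  have pos: "0 < P i s" "0 < P (Suc i) s" "0 < P (Suc (Suc i)) s" "0 < growth"
    using P_pos s growth_bounds by auto
  have dd: "d i = (\<lambda>s. (P i s)\<^sup>2 / (growth * P (Suc i) s * P (Suc (Suc i)) s))"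
    by (auto simp: d_def inflow_def P_def)
  show ?thesis unfolding dd
    by (rule derivative_eq_intros P_deriv[OF s] refl)+
       (use pos in \<open>simp_all add: field_simps power2_eq_square\<close>)
qed

lemma \<xi>_bounds:
  assumes "s \<le> T"
  shows "0 \<le> \<xi> j s" "j \<le> Suc (Suc i) \<Longrightarrow> \<xi> j s / speed i s \<le> 1/5000"
proof -
  show "0 \<le> \<xi> j s" unfolding \<xi>_def using T env_log_deriv_nonneg[OF clock_nonneg[OF assms]] by simp
  assume "j \<le> Suc (Suc i)"
  hence "env_log_deriv (1 - s / T) j \<le> 20 * (growth ^ Suc i * P (Suc (Suc i)) s)"
    unfolding P_def by (intro env_log_deriv_le clock_nonneg assms)
  hence "\<xi> j s \<le> (20 / T) * (growth ^ Suc i * P (Suc (Suc i)) s)"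
    unfolding \<xi>_def using T by (simp add: field_simps)
  also have "\<dots> \<le> (K / 5000) * (growth ^ Suc i * P (Suc (Suc i)) s)"
    using K growth_bounds P_pos[OF assms, of "Suc (Suc i)"] by (intro mult_right_mono) auto
  finally have "\<xi> j s \<le> 1/5000 * speed i s" by (simp add: speed_def)
  thus "\<xi> j s / speed i s \<le> 1/5000"
    using speed_pos[OF assms, of i] by (simp add: divide_le_eq)
qed

text \<open>In the second inequality the product equals the square of the ratio of the envelope values at \<open>i + 1\<close>
and \<open>i + 2\<close>.\<close>

lemma speed_ratio:
  assumes "s \<le> T"
  shows "3729/1000 \<le> speed (Suc i) s / speed i s"
    and "98/100 \<le> speed (Suc i) s / speed i s * d (Suc i) s"
proof -
  note \<tau> = clock_nonneg[OF assms]
  let ?q = "P (Suc i) s" and ?r = "P (Suc (Suc i)) s" and ?s = "P (Suc (Suc (Suc i))) s"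
  have pos: "0 < ?q" "0 < ?r" "0 < ?s" "0 < growth" "0 < K"
    using P_pos assms growth_bounds K_pos by auto
  have L: "speed (Suc i) s / speed i s = growth * ?s / ?r"
    using pos by (simp add: speed_def field_simps)
  have "3729/1000 * ?r \<le> 3729/1000 * (15165/10000 * ?s)"
    using env_le_Suc[OF \<tau>, of "Suc (Suc i)"] by (simp add: P_def)
  also have "\<dots> \<le> 5656/1000 * ?s" using pos by simp
  also have "\<dots> \<le> growth * ?s" using pos growth_bounds by (intro mult_right_mono) auto
  finally show "3729/1000 \<le> speed (Suc i) s / speed i s"
    unfolding L using pos by (simp add: field_simps)
  have "98/100 * ?r\<^sup>2 \<le> 98/100 * (10085/10000 * ?q)\<^sup>2"
    using env_Suc_le[OF \<tau>, of "Suc i"] pos by (intro mult_left_mono power_mono) (auto simp: P_def)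
  also have "\<dots> \<le> ?q\<^sup>2" using pos by (simp add: power_mult_distrib power_divide)
  finally have "98/100 \<le> ?q\<^sup>2 / ?r\<^sup>2" using pos by (simp add: field_simps)
  also have "\<dots> = growth * ?s / ?r * d (Suc i) s"
    using pos by (simp add: d_def inflow_def P_def field_simps power2_eq_square)
  finally show "98/100 \<le> speed (Suc i) s / speed i s * d (Suc i) s" unfolding L .
qed

section \<open>The region is invariant\<close>

definition right_excess :: "nat \<Rightarrow> real \<Rightarrow> real" where
  "right_excess i s = b (Suc i) s - 1"
definition diagonal_excess :: "nat \<Rightarrow> real \<Rightarrow> real" where
  "diagonal_excess i s = b (Suc (Suc i)) s - (5/8 * b (Suc i) s + 11/20)"
definition bottom_excess :: "nat \<Rightarrow> real \<Rightarrow> real" where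
  "bottom_excess i s = d i s * profile (b (Suc i) s) - b (Suc (Suc i)) s"

definition trapped :: "real \<Rightarrow> bool" where
  "trapped s \<longleftrightarrow> (\<forall>i. right_excess i s \<le> 0 \<and> diagonal_excess i s \<le> 0 \<and> bottom_excess i s \<le> 0)"

lemma trappedD:
  assumes "trapped s"
  shows "b (Suc i) s \<le> 1" "b (Suc (Suc i)) s \<le> 5/8 * b (Suc i) s + 11/20"
    "d i s * profile (b (Suc i) s) \<le> b (Suc (Suc i)) s"
  using assms by (simp_all add: trapped_def right_excess_def diagonal_excess_def bottom_excess_def)

lemma d_bounds: "s \<le> T \<Longrightarrow> d i s \<le> 617/1000" "s \<le> T \<Longrightarrow> 17/100 \<le> d i s"
    "s \<le> T \<Longrightarrow> 988/1000 * d i s \<le> d (Suc i) s"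
  unfolding d_def by (intro inflow_bounds inflow_slowly_varying clock_nonneg; assumption)+

lemma trapped_le_1:
  assumes "trapped s" "0 \<le> s" shows "b j s \<le> 1"
proof (cases j)
  case 0
  thus ?thesis using boundary[OF assms(2)] by (simp add: b_def)
next
  case (Suc i)
  thus ?thesis using assms by (simp add: trapped_def right_excess_def)
qed

lemma right_inward:
  assumes s: "0 < s" "s \<le> T" and "trapped s" "right_excess i s = 0"
  shows "\<exists>D<0. (right_excess i has_real_derivative D) (at s)"
proof -
  let ?v = "\<xi> (Suc i) s / speed i s * b (Suc i) s + d i s * (b i s)\<^sup>2 - b (Suc i) s * b (Suc (Suc i)) s"
  have x: "b (Suc i) s = 1" using assms by (simp add: right_excess_def)
  have "d i s * profile 1 \<le> b (Suc (Suc i)) s"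
    using trappedD(3)[OF \<open>trapped s\<close>, of i] x by simp
  hence "?v < 0"
    using right_edge[of "d i s" "b (Suc (Suc i)) s" "b i s" "\<xi> (Suc i) s / speed i s"]
      s d_bounds[of s i] b_nonneg[of s i] trapped_le_1[OF \<open>trapped s\<close>, of i] \<xi>_bounds(2)[of s "Suc i" i] x
    by simp
  hence "speed i s * ?v < 0" using speed_pos[of s i] s by (simp add: mult_pos_neg)
  moreover have "(right_excess i has_real_derivative speed i s * ?v) (at s)"
    unfolding right_excess_def[abs_def] using DERIV_diff[OF b_deriv[OF s, of i] DERIV_const] by simp
  ultimately show ?thesis by blast
qed

lemma diagonal_inward:
  assumes s: "0 < s" "s \<le> T" and tr: "trapped s" and "diagonal_excess i s = 0"
  shows "\<exists>D<0. (diagonal_excess i has_real_derivative D) (at s)"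
proof -
  define k L where "k = speed i s" and "L = speed (Suc i) s / speed i s"
  define w x y z where "w = b i s" and "x = b (Suc i) s" and "y = b (Suc (Suc i)) s"
    and "z = b (Suc (Suc (Suc i))) s"
  define \<eta> \<eta>' where "\<eta> = \<xi> (Suc i) s / k" and "\<eta>' = \<xi> (Suc (Suc i)) s / k"
  have k: "0 < k" using speed_pos s by (simp add: k_def)
  have kL: "speed (Suc i) s = k * L" using k by (simp add: k_def L_def)
  have L: "3729/1000 \<le> L" "98/100 \<le> L * d (Suc i) s"
    unfolding L_def using speed_ratio s by auto
  have dx: "(b (Suc i) has_real_derivative k * (\<eta> * x + d i s * w\<^sup>2 - x * y)) (at s)"
    using b_deriv[OF s, of i] by (simp add: k_def \<eta>_def w_def x_def y_def)
  have dy: "(b (Suc (Suc i)) has_real_derivative k * (\<eta>' * y + L * (d (Suc i) s * x\<^sup>2 - y * z))) (at s)"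
    using b_deriv[OF s, of "Suc i"] k L unfolding kL
    by (simp add: \<eta>'_def x_def y_def z_def algebra_simps)
  have "\<eta>' * y + L * (d (Suc i) s * x\<^sup>2 - y * z) - 5/8 * (\<eta> * x + d i s * w\<^sup>2 - x * y) < 0"
  proof (rule diagonal_edge)
    show "0 \<le> x" "x \<le> 1" "y \<le> 1"
      using b_nonneg trapped_le_1[OF tr] s by (auto simp: x_def y_def)
    show "y = 5/8 * x + 11/20" using assms by (simp add: diagonal_excess_def x_def y_def)
    show "0 \<le> d i s" using d_bounds(2)[of s i] s by simp
    show "0 \<le> L" "98/100 \<le> L * d (Suc i) s" using L by auto
    show "d (Suc i) s * profile y \<le> z"
      unfolding y_def z_def by (rule trappedD(3)[OF tr])
    show "0 \<le> \<eta>" unfolding \<eta>_def using \<xi>_bounds(1) s k by simp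
    show "\<eta>' \<le> 1/5000" unfolding \<eta>'_def k_def using \<xi>_bounds(2)[of s "Suc (Suc i)" i] s by simp
  qed
  hence "k * (\<eta>' * y + L * (d (Suc i) s * x\<^sup>2 - y * z) - 5/8 * (\<eta> * x + d i s * w\<^sup>2 - x * y)) < 0"
    using k by (simp add: mult_pos_neg)
  moreover have "(diagonal_excess i has_real_derivative
      k * (\<eta>' * y + L * (d (Suc i) s * x\<^sup>2 - y * z) - 5/8 * (\<eta> * x + d i s * w\<^sup>2 - x * y))) (at s)"
    unfolding diagonal_excess_def[abs_def]
    by (rule derivative_eq_intros dx dy refl)+ (simp add: algebra_simps)
  ultimately show ?thesis by blast
qed

lemma bottom_inward:
  assumes s: "0 < s" "s \<le> T" and tr: "trapped s" and "bottom_excess i s = 0"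
  shows "\<exists>D<0. (bottom_excess i has_real_derivative D) (at s)"
proof -
  define k L where "k = speed i s" and "L = speed (Suc i) s / speed i s"
  define w x y z where "w = b i s" and "x = b (Suc i) s" and "y = b (Suc (Suc i)) s"
    and "z = b (Suc (Suc (Suc i))) s"
  define \<eta> \<eta>' \<zeta> where "\<eta> = \<xi> (Suc i) s / k" and "\<eta>' = \<xi> (Suc (Suc i)) s / k"
    and "\<zeta> = (\<xi> (Suc i) s + \<xi> (Suc (Suc i)) s - 2 * \<xi> i s) / k"
  have k: "0 < k" using speed_pos s by (simp add: k_def)
  have kL: "speed (Suc i) s = k * L" using k by (simp add: k_def L_def)
  have L: "3729/1000 \<le> L" unfolding L_def using speed_ratio s by auto
  have dx: "(b (Suc i) has_real_derivative k * (\<eta> * x + d i s * w\<^sup>2 - x * y)) (at s)"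
    using b_deriv[OF s, of i] by (simp add: k_def \<eta>_def w_def x_def y_def)
  have dy: "(b (Suc (Suc i)) has_real_derivative k * (\<eta>' * y + L * (d (Suc i) s * x\<^sup>2 - y * z))) (at s)"
    using b_deriv[OF s, of "Suc i"] k L unfolding kL
    by (simp add: \<eta>'_def x_def y_def z_def algebra_simps)
  have dd: "(d i has_real_derivative k * (d i s * \<zeta>)) (at s)"
    using d_deriv[of s i] s k by (simp add: \<zeta>_def)
  have \<eta>: "0 \<le> \<eta>" "\<eta> \<le> 1/5000" "0 \<le> \<eta>'" "\<eta>' \<le> 1/5000"
    unfolding \<eta>_def \<eta>'_def k_def
    using \<xi>_bounds(1)[OF s(2)] \<xi>_bounds(2)[OF s(2), of _ i] speed_pos[OF s(2), of i]
    by (simp_all add: less_imp_le del: divide_le_eq_numeral1 divide_le_eq_1)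
  have "d i s * \<zeta> * profile x + d i s * (68/25 * x) * (\<eta> * x + d i s * w\<^sup>2 - x * y)
      < \<eta>' * y + L * (d (Suc i) s * x\<^sup>2 - y * z)"
  proof (rule bottom_edge)
    show "0 \<le> x" "x \<le> 1" "0 \<le> y" "0 \<le> w" "w \<le> 1"
      using b_nonneg trapped_le_1[OF tr] s by (auto simp: x_def y_def w_def)
    show "y = d i s * profile x" using assms by (simp add: bottom_excess_def x_def y_def)
    show "0 < d i s" "d i s \<le> 617/1000" "988/1000 * d i s \<le> d (Suc i) s"
      using d_bounds[of s i] s by simp_all
    show "z \<le> 5/8 * y + 11/20"
      unfolding y_def z_def by (rule trappedD(2)[OF tr])
    have "\<zeta> = \<eta> + \<eta>' - 2 * (\<xi> i s / k)"
      by (simp add: \<zeta>_def \<eta>_def \<eta>'_def add_divide_distrib diff_divide_distrib)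
    moreover have "0 \<le> \<xi> i s / k" using \<xi>_bounds(1)[of s i] s k by simp
    ultimately show "\<zeta> \<le> 2/5000" using \<eta> by linarith
  qed (use L \<eta> in auto)
  hence "k * (d i s * \<zeta> * profile x + d i s * (68/25 * x) * (\<eta> * x + d i s * w\<^sup>2 - x * y)
      - (\<eta>' * y + L * (d (Suc i) s * x\<^sup>2 - y * z))) < 0"
    using k by (simp add: mult_pos_neg)
  moreover have "(bottom_excess i has_real_derivative
      k * (d i s * \<zeta> * profile x + d i s * (68/25 * x) * (\<eta> * x + d i s * w\<^sup>2 - x * y)
      - (\<eta>' * y + L * (d (Suc i) s * x\<^sup>2 - y * z)))) (at s)"
    unfolding bottom_excess_def[abs_def] profile_def
    by (rule derivative_eq_intros dx dy dd refl)+ (simp add: x_def profile_def field_simps)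
  ultimately show ?thesis by blast
qed

lemma continuous_excess:
  assumes "t \<le> T"
  shows "continuous_on {0..t} (right_excess i)" "continuous_on {0..t} (diagonal_excess i)"
    "continuous_on {0..t} (bottom_excess i)"
proof -
  have "continuous_on {0..t} (a (Suc j))" for j
    by (rule DERIV_continuous_on) (rule DERIV_subset[OF evolution], auto)
  moreover have P: "continuous_on {0..t} (P j)" "\<forall>s\<in>{0..t}. P j s \<noteq> 0" for j
    using assms P_pos by (auto intro!: continuous_at_imp_continuous_on DERIV_isCont[OF P_deriv] simp: less_imp_neq[symmetric])
  ultimately have b: "continuous_on {0..t} (b (Suc j))" for j
    unfolding b_def[abs_def] using K_pos by (intro continuous_intros) auto
  have d: "continuous_on {0..t} (d i)"
    using assms by (auto intro!: continuous_at_imp_continuous_on DERIV_isCont[OF d_deriv])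
  show "continuous_on {0..t} (right_excess i)" "continuous_on {0..t} (diagonal_excess i)"
    "continuous_on {0..t} (bottom_excess i)"
    unfolding right_excess_def[abs_def] diagonal_excess_def[abs_def] bottom_excess_def[abs_def] profile_def
    by (intro continuous_intros b d)+
qed

lemma initially_deep_inside:
  "right_excess i 0 < 0" "diagonal_excess i 0 < 0" "bottom_excess i 0 < 0"
proof -
  have b: "0 \<le> b j 0" "b j 0 \<le> 1/4" for j
  proof -
    show "0 \<le> b j 0" using b_nonneg T by simp
    have "a j 0 \<le> 1/4 * K" using bounded[of 0 j] K by simp
    also have "\<dots> \<le> 1/4 * (K * P j 0)" using env_ge_at_start[of j] K_pos by (simp add: P_def)
    finally show "b j 0 \<le> 1/4" using P_pos[of 0 j] K_pos T by (simp add: b_def field_simps)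
  qed
  show "right_excess i 0 < 0" "diagonal_excess i 0 < 0"
    using b[of "Suc i"] b[of "Suc (Suc i)"] by (simp_all add: right_excess_def diagonal_excess_def)
  have "profile (b (Suc i) 0) < 0"
    using profile_mono[OF b, of "Suc i"] by (simp add: profile_def power2_eq_square)
  hence "d i 0 * profile (b (Suc i) 0) < 0"
    using d_bounds(2)[of 0 i] T by (intro mult_pos_neg) auto
  thus "bottom_excess i 0 < 0" using b[of "Suc (Suc i)"] by (simp add: bottom_excess_def)
qed

lemma tail_small:
  assumes "t < T"
  obtains J where "\<And>j s. J \<le> j \<Longrightarrow> 0 \<le> s \<Longrightarrow> s \<le> t \<Longrightarrow> b j s \<le> 1/2"
proof -
  define \<tau> where "\<tau> = 1 - t / T"
  have \<tau>: "0 < \<tau>" using assms T by (simp add: \<tau>_def)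
  obtain J where J: "2 * E / (K * \<tau> ^ 12) < (10007/10000) ^ J"
    using real_arch_pow[of "10007/10000" "2 * E / (K * \<tau> ^ 12)"] by auto
  have "b j s \<le> 1/2" if "J \<le> j" "0 \<le> s" "s \<le> t" for j s
  proof -
    have "2 * E \<le> K * (\<tau> ^ 12 * (10007/10000) ^ J)"
      using J K_pos \<tau> by (simp add: field_simps)
    also have "\<dots> \<le> K * (\<tau> ^ 12 * (10007/10000) ^ j)"
      using K_pos \<tau> that by (intro mult_left_mono power_increasing) auto
    also have "\<dots> \<le> K * P j s"
      unfolding P_def using K_pos \<tau> that T
      by (intro mult_left_mono env_unbounded) (auto simp: \<tau>_def divide_right_mono)
    finally have "2 * E \<le> K * P j s" .
    hence "a j s \<le> 1/2 * (K * P j s)" using bounded[of s j] that by simp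
    thus ?thesis using P_pos[of s j] K_pos that assms by (simp add: b_def field_simps)
  qed
  thus ?thesis using that by blast
qed

text \<open>Above the index \<open>J\<close> of \<open>tail_small\<close> all components are at most \<open>1/2\<close>, where the three
inequalities hold of themselves; the finitely many others are barriers in the sense of
\<open>finite_barrier\<close>.\<close>

lemma below_envelope:
  assumes "0 \<le> t" "t < T"
  shows "a j t \<le> K * P j t"
proof -
  obtain J where J: "\<And>j s. J \<le> j \<Longrightarrow> 0 \<le> s \<Longrightarrow> s \<le> t \<Longrightarrow> b j s \<le> 1/2"
    using tail_small[OF \<open>t < T\<close>] by blast
  define \<Phi> where "\<Phi> = right_excess ` {..<J} \<union> diagonal_excess ` {..<J} \<union> bottom_excess ` {..<J}"
  have trapped: "trapped s" if s: "0 \<le> s" "s \<le> t" and \<Phi>: "\<And>f. f \<in> \<Phi> \<Longrightarrow> f s \<le> 0" for s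
    unfolding trapped_def
  proof
    fix i
    show "right_excess i s \<le> 0 \<and> diagonal_excess i s \<le> 0 \<and> bottom_excess i s \<le> 0"
    proof (cases "i < J")
      case True
      thus ?thesis using \<Phi> by (auto simp: \<Phi>_def)
    next
      case False
      hence x: "b (Suc i) s \<le> 1/2" "b (Suc (Suc i)) s \<le> 1/2" using J s by auto
      have x0: "0 \<le> b (Suc i) s" "0 \<le> b (Suc (Suc i)) s" using b_nonneg s assms by auto
      have "profile (b (Suc i) s) \<le> 0"
        using profile_mono[OF x0(1) x(1)] by (simp add: profile_def power2_eq_square)
      hence "d i s * profile (b (Suc i) s) \<le> 0"
        using d_bounds(2)[of s i] s assms by (intro mult_nonneg_nonpos) auto
      thus ?thesis using x x0 by (simp add: right_excess_def diagonal_excess_def bottom_excess_def)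
    qed
  qed
  have "f t \<le> 0" if f: "f \<in> \<Phi>" for f
  proof (rule less_imp_le, rule finite_barrier[of \<Phi> t, OF _ _ _ _ f])
    fix f s assume f: "f \<in> \<Phi>" "0 < s" "s \<le> t" "f s = 0" and le: "\<And>g. g \<in> \<Phi> \<Longrightarrow> g s \<le> 0"
    have "trapped s" using f le by (intro trapped) auto
    moreover have "s \<le> T" using f assms by simp
    ultimately show "\<exists>D<0. (f has_real_derivative D) (at s)"
      using f right_inward diagonal_inward bottom_inward unfolding \<Phi>_def by blast
  qed (use initially_deep_inside continuous_excess[of t] assms in \<open>auto simp: \<Phi>_def\<close>)
  hence "b j t \<le> 1"
    using trapped_le_1[OF trapped[of t]] assms by simp
  thus ?thesis using P_pos[of t j] K_pos assms by (simp add: b_def field_simps)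
qed

text \<open>The envelope bounds the solution strictly before \<open>T\<close>, while it still tends to infinity with the index; the bound at \<open>T\<close>
follows by continuity.\<close>

lemma bound_at_T: "a j T \<le> K * (9659/10000) ^ (12 * j)"
proof -
  have c: "continuous_on {0..T} (\<lambda>s. a j s - K * P j s)"
  proof -
    have "continuous_on {0..T} (a j)"
    proof (cases j)
      case 0
      have "continuous_on {0..T} (a 0) = continuous_on {0..T} (\<lambda>s. 0::real)"
        by (rule continuous_on_cong) (auto simp: boundary)
      thus ?thesis using 0 by simp
    next
      case (Suc i)
      show ?thesis unfolding Suc
        by (rule DERIV_continuous_on) (rule DERIV_subset[OF evolution], auto)
    qed
    moreover have "continuous_on {0..T} (P j)"
      by (auto intro!: continuous_at_imp_continuous_on DERIV_isCont[OF P_deriv])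
    ultimately show ?thesis by (intro continuous_intros)
  qed
  have "a j T - K * P j T \<le> 0"
    using continuous_le_on_closure[of "{0..<T}" "\<lambda>s. a j s - K * P j s" T 0] c below_envelope T by auto
  moreover have "P j T = (9659/10000) ^ (12 * j)"
    using T by (simp add: P_def env_def env_root_def mult.commute flip: power_mult)
  ultimately show ?thesis by simp
qed

end

section \<open>Regularity at positive times\<close>

lemma ratio_powr: "2 powr (3/5) * (9659/10000) ^ 12 \<le> (1::real)"
proof -
  have "(2 powr (3/5)) ^ 5 = (8::real)" by (simp add: powr_power)
  also have "(8::real) \<le> (1516/1000) ^ 5" by (simp add: power_divide)
  finally have "2 powr (3/5) \<le> (1516/1000::real)"
    using power_mono_iff[of "2 powr (3/5)" "1516/1000::real" 5] by simp
  hence "2 powr (3/5) * (9659/10000) ^ 12 \<le> 1516/1000 * (9659/10000::real) ^ 12"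
    by (intro mult_right_mono) auto
  also have "\<dots> \<le> 1" by (simp add: power_divide)
  finally show ?thesis .
qed

theorem theorem1p1:
  fixes a :: "nat \<Rightarrow> real \<Rightarrow> real" and \<theta> t :: real
  assumes "\<theta> = 3/5"
    and "positive_solution a"
    and "square_summable (\<lambda>j. a j 0)"
    and "t > 0"
  shows "(SUP j. ereal (lam j powr \<theta> * a j t)) < \<infinity>"
proof -
  have pos: "0 \<le> a j s" if "0 \<le> s" for j s
    using assms(2) that by (simp add: positive_solution_def)
  obtain a' where a': "\<forall>j. (\<forall>t\<ge>0. (a j has_real_derivative a' j t) (at t within {0..})) \<and>
               continuous_on {0..} (a' j)"
    "\<forall>j\<ge>1. \<forall>t\<ge>0. a' j t = lam (j - 1) powr (5/2) * (a (j - 1) t)\<^sup>2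
               - lam j powr (5/2) * a j t * a (j + 1) t"
    "\<forall>t\<ge>0. a 0 t = 0"
    using assms(2) unfolding positive_solution_def dyadic_solution_def by (elim conjE exE) rule
  have zero: "a 0 s = 0" if "0 \<le> s" for s using a'(3) that by simp
  have evol: "(a (Suc i) has_real_derivative
      growth ^ i * (a i s)\<^sup>2 - growth ^ Suc i * a (Suc i) s * a (Suc (Suc i)) s) (at s within {0..})"
    if "0 \<le> s" for i s
  proof -
    have "a' (Suc i) s = growth ^ i * (a i s)\<^sup>2 - growth ^ Suc i * a (Suc i) s * a (Suc (Suc i)) s"
      using a'(2)[rule_format, of "Suc i" s] that unfolding lam_powr by simp
    moreover have "(a (Suc i) has_real_derivative a' (Suc i) s) (at s within {0..})"
      using a'(1) that by simp
    ultimately show ?thesis by simp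
  qed
  have summ: "summable (\<lambda>j. (a j 0)\<^sup>2)" using assms(3) by (simp add: square_summable_def)
  define E where "E = sqrt (\<Sum>j. (a j 0)\<^sup>2)"
  define K where "K = max (100000 / t) (4 * E)"
  have "a j s \<le> E" if "0 \<le> s" for j s
    unfolding E_def by (rule real_le_rsqrt) (rule energy_bound[OF pos zero evol summ that])
  then interpret cascade a E K t
    using pos zero evol assms(4) by unfold_locales (auto simp: K_def)
  have alg: "x ^ j * (k * r ^ (12 * j)) = k * (x * r ^ 12) ^ j" for x k r :: real and j
    by (simp add: power_mult_distrib power_mult)
  have "lam j powr \<theta> * a j t \<le> K" for j
  proof -
    have l: "lam j powr \<theta> = (2 powr (3/5)) ^ j"
      by (simp add: lam_def assms(1) powr_powr mult.commute flip: powr_realpow)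
    have "lam j powr \<theta> * a j t \<le> (2 powr (3/5)) ^ j * (K * (9659/10000) ^ (12 * j))"
      unfolding l by (intro mult_left_mono bound_at_T) auto
    also have "\<dots> = K * (2 powr (3/5) * (9659/10000) ^ 12) ^ j"
      using alg[of "2 powr (3/5)" j K "9659/10000"] .
    also have "\<dots> \<le> K * 1"
      using ratio_powr K_pos by (intro mult_left_mono power_le_one) auto
    finally show ?thesis by simp
  qed
  hence "(SUP j. ereal (lam j powr \<theta> * a j t)) \<le> ereal K" by (intro SUP_least) simp
  thus ?thesis using le_less_trans by fastforce
qed

end
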